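(* Let $f\in\mathcal{C}(\Omega)$ and $\lambda>0$, let the quadrature rule have exactness degree $2n$, and let $f^{\epsilon}=f+\epsilon$ be a noisy version of $f$, where the noise $\epsilon$ is a function in $\mathcal{C}(\Omega)$. Then $$\|\mathcal{H}_n^{\lambda}f\|_2\le V^{1/2}\|f\|_\infty$$ and $$\|\mathcal{H}_n^{\lambda}f^{\epsilon}-f\|_2\le\|\mathcal{H}_n^{\lambda}f^{\epsilon}-\mathcal{L}_nf^{\epsilon}\|_2+2V^{1/2}E_n(f)+V^{1/2}\|\epsilon\|_\infty.$$ Thus $$\lim_{n\to\infty}\lim_{\lambda\to0}\|\mathcal{H}_n^{\lambda}f^{\epsilon}-f\|_2=V^{1/2}\|\epsilon\|_\infty.$$
   Context: $\Omega\subset\mathbb{R}^s$ is a compact smooth Riemannian manifold with smooth or empty boundary, equipped with a measure $\mathrm{d}\omega$ with $\int_\Omega \mathrm{d}\omega=V<\infty$. $\mathcal{C}(\Omega)$ is the space of continuous real functions on $\Omega$, $\langle f,g\rangle=\int_\Omega fg\,\mathrm{d}\omega$, $\|g\|_2=\langle g,g\rangle^{1/2}$, $\|g\|_\infty=\sup_{\mathbf{x}\in\Omega}|g(\mathbf{x})|$. $\mathbb{P}_n(\Omega)$ is the space of polynomials of total degree at most $n$ restricted to $\Omega$, $d_n=\dim\mathbb{P}_n(\Omega)$, $\{\Phi_\ell\}_{\ell=1}^{d_n}$ is a fixed orthonormal basis of $\mathbb{P}_n(\Omega)$ with respect to $\langle\cdot,\cdot\rangle$, and $E_n(f)=\inf\{\|f-p\|_\infty:p\in\mathbb{P}_n(\Omega)\}$.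 Quadrature rule (one for each $n$): nodes $\mathbf{x}_1,\dots,\mathbf{x}_N\in\Omega$ and weights $w_1,\dots,w_N>0$ such that $\int_\Omega p\,\mathrm{d}\omega=\sum_{j=1}^N w_jp(\mathbf{x}_j)$ for all $p\in\mathbb{P}_{2n}(\Omega)$ (exactness degree $2n$). The discrete (semi) inner product is $\langle f,g\rangle_N=\sum_{j=1}^N w_jf(\mathbf{x}_j)g(\mathbf{x}_j)$. Hyperinterpolation: $\mathcal{L}_nf=\sum_{\ell=1}^{d_n}\langle f,\Phi_\ell\rangle_N\Phi_\ell$. Hard thresholding hyperinterpolation: $\mathcal{H}_n^\lambda f=\sum_{\ell=1}^{d_n}\eta_H(\langle f,\Phi_\ell\rangle_N,\lambda)\Phi_\ell$ for $\lambda>0$, with hard thresholding operator $\eta_H(a,k)=a$ if $|a|>k$ and $\eta_H(a,k)=0$ if $|a|\le k$.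
   Formalization: The final equality is false (Ω=[0,1], f=0, ε(x)=x gives 1/√3, not 1); proved instead: the iterated limit of the error is ‖ε‖_2, which is ≤ V^{1/2}‖ε‖_∞, and the right-hand side of the second inequality has iterated limit V^{1/2}‖ε‖_∞. *)

theory Defs
  imports "HOL-Analysis.Analysis" "HOL-Library.Function_Algebras"
begin

section \<open>Smooth submanifolds of Euclidean space, possibly with boundary\<close>

text \<open>\<open>C\<^sup>k\<close> maps on an open set \<open>U\<close>: all iterated directional derivatives up to order
  \<open>k\<close> exist on \<open>U\<close> (with \<open>f\<close> totally differentiable at each stage) and are continuous.\<close>

primrec Ck_on :: "nat \<Rightarrow> ('a::euclidean_space \<Rightarrow> 'b::euclidean_space) \<Rightarrow> 'a set \<Rightarrow> bool" where
  "Ck_on 0 f U \<longleftrightarrow> continuous_on U f"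
| "Ck_on (Suc k) f U \<longleftrightarrow>
     (\<forall>x\<in>U. f differentiable (at x)) \<and> (\<forall>v. Ck_on k (\<lambda>x. frechet_derivative f (at x) v) U)"

definition smooth_on_open :: "('a::euclidean_space \<Rightarrow> 'b::euclidean_space) \<Rightarrow> 'a set \<Rightarrow> bool" where
  "smooth_on_open f U \<longleftrightarrow> open U \<and> (\<forall>k. Ck_on k f U)"

text \<open>Embedded submanifold of dimension \<open>d\<close> with smooth (possibly empty) boundary: a
  diffeomorphism of ambient open sets straightens \<open>\<Omega>\<close>, near each of its points, to a
  \<open>d\<close>-dimensional linear subspace \<open>T\<close> or to a closed half-space of such a \<open>T\<close>.  The
  Riemannian metric is the one induced by the ambient Euclidean inner product.\<close>

definition smooth_submanifold :: "nat \<Rightarrow> 'a::euclidean_space set \<Rightarrow> bool" where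
  "smooth_submanifold d \<Omega> \<longleftrightarrow>
     (\<forall>x\<in>\<Omega>. \<exists>U W (\<phi> :: 'a \<Rightarrow> 'a) (\<psi> :: 'a \<Rightarrow> 'a) T.
        x \<in> U \<and> smooth_on_open \<phi> U \<and> smooth_on_open \<psi> W \<and> homeomorphism U W \<phi> \<psi> \<and>
        subspace T \<and> dim T = d \<and>
        (\<phi> ` (\<Omega> \<inter> U) = W \<inter> T \<or>
         (\<exists>\<nu>\<in>T. \<nu> \<noteq> 0 \<and> \<phi> ` (\<Omega> \<inter> U) = W \<inter> T \<inter> {y. 0 \<le> \<nu> \<bullet> y})))"

section \<open>Inner products, norms and polynomial spaces\<close>

definition L2_inner :: "'a measure \<Rightarrow> ('a \<Rightarrow> real) \<Rightarrow> ('a \<Rightarrow> real) \<Rightarrow> real" where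
  "L2_inner M f g = (\<integral>x. f x * g x \<partial>M)"

definition L2_norm :: "'a measure \<Rightarrow> ('a \<Rightarrow> real) \<Rightarrow> real" where
  "L2_norm M g = sqrt (L2_inner M g g)"

definition sup_norm :: "'a set \<Rightarrow> ('a \<Rightarrow> real) \<Rightarrow> real" where
  "sup_norm \<Omega> g = (SUP x\<in>\<Omega>. \<bar>g x\<bar>)"

text \<open>Real functions as a vector space under pointwise operations (the additive group structure is
  that of \<open>HOL-Library.Function_Algebras\<close>).\<close>

interpretation fun_vs: vector_space "\<lambda>(c::real) (f::'a \<Rightarrow> real) x. c * f x"
  by unfold_locales (auto simp: fun_eq_iff algebra_simps)

text \<open>Functions on \<open>\<Omega>\<close> are represented by functions on the ambient space that are extended by
  zero outside \<open>\<Omega>\<close>, so that functions agreeing on \<open>\<Omega>\<close> are identified and linear independence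
  and dimension are those of the restrictions to \<open>\<Omega>\<close>.\<close>

definition monomial_on :: "(real ^ 's) set \<Rightarrow> ('s \<Rightarrow> nat) \<Rightarrow> real ^ 's \<Rightarrow> real" where
  "monomial_on \<Omega> \<alpha> x = (if x \<in> \<Omega> then \<Prod>i\<in>UNIV. (x $ i) ^ \<alpha> i else 0)"

definition poly_space :: "nat \<Rightarrow> (real ^ 's) set \<Rightarrow> (real ^ 's \<Rightarrow> real) set" where
  "poly_space n \<Omega> = fun_vs.span (monomial_on \<Omega> ` {\<alpha>. (\<Sum>i\<in>UNIV. \<alpha> i) \<le> n})"

definition poly_dim :: "nat \<Rightarrow> (real ^ 's) set \<Rightarrow> nat" where
  "poly_dim n \<Omega> = fun_vs.dim (poly_space n \<Omega>)"

definition best_approx_error :: "nat \<Rightarrow> (real ^ 's) set \<Rightarrow> (real ^ 's \<Rightarrow> real) \<Rightarrow> real" where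
  "best_approx_error n \<Omega> f = (INF p\<in>poly_space n \<Omega>. sup_norm \<Omega> (\<lambda>x. f x - p x))"

definition orthonormal_basis ::
    "nat \<Rightarrow> (real ^ 's) set \<Rightarrow> (real ^ 's) measure \<Rightarrow> (nat \<Rightarrow> real ^ 's \<Rightarrow> real) \<Rightarrow> bool" where
  "orthonormal_basis n \<Omega> M \<Phi> \<longleftrightarrow>
     fun_vs.independent (\<Phi> ` {1..poly_dim n \<Omega>}) \<and>
     fun_vs.span (\<Phi> ` {1..poly_dim n \<Omega>}) = poly_space n \<Omega> \<and>
     (\<forall>k\<in>{1..poly_dim n \<Omega>}. \<forall>l\<in>{1..poly_dim n \<Omega>}.
        L2_inner M (\<Phi> k) (\<Phi> l) = (if k = l then 1 else 0))"

section \<open>Quadrature and hyperinterpolation\<close>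

definition quadrature_rule ::
    "nat \<Rightarrow> (real ^ 's) set \<Rightarrow> (real ^ 's) measure \<Rightarrow> nat \<Rightarrow> (nat \<Rightarrow> real ^ 's) \<Rightarrow> (nat \<Rightarrow> real) \<Rightarrow> bool" where
  "quadrature_rule m \<Omega> M N x w \<longleftrightarrow>
     (\<forall>j\<in>{1..N}. x j \<in> \<Omega> \<and> 0 < w j) \<and>
     (\<forall>p\<in>poly_space m \<Omega>. (\<integral>y. p y \<partial>M) = (\<Sum>j=1..N. w j * p (x j)))"

definition discrete_inner ::
    "nat \<Rightarrow> (nat \<Rightarrow> 'a) \<Rightarrow> (nat \<Rightarrow> real) \<Rightarrow> ('a \<Rightarrow> real) \<Rightarrow> ('a \<Rightarrow> real) \<Rightarrow> real" where
  "discrete_inner N x w f g = (\<Sum>j=1..N. w j * f (x j) * g (x j))"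

definition hard_threshold :: "real \<Rightarrow> real \<Rightarrow> real" where
  "hard_threshold a k = (if \<bar>a\<bar> > k then a else 0)"

text \<open>In the next two definitions \<open>d\<close> is the number of basis functions
  \<open>\<Phi> 1, \<dots>, \<Phi> d\<close>.\<close>

definition hyperinterp ::
    "nat \<Rightarrow> nat \<Rightarrow> (nat \<Rightarrow> 'a) \<Rightarrow> (nat \<Rightarrow> real) \<Rightarrow> (nat \<Rightarrow> 'a \<Rightarrow> real) \<Rightarrow> ('a \<Rightarrow> real) \<Rightarrow> 'a \<Rightarrow> real" where
  "hyperinterp d N x w \<Phi> f y = (\<Sum>l=1..d. discrete_inner N x w f (\<Phi> l) * \<Phi> l y)"

definition hard_hyperinterp ::
    "nat \<Rightarrow> nat \<Rightarrow> (nat \<Rightarrow> 'a) \<Rightarrow> (nat \<Rightarrow> real) \<Rightarrow> (nat \<Rightarrow> 'a \<Rightarrow> real) \<Rightarrow> real \<Rightarrow> ('a \<Rightarrow> real) \<Rightarrow> 'a \<Rightarrow> real" where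
  "hard_hyperinterp d N x w \<Phi> \<mu> f y =
     (\<Sum>l=1..d. hard_threshold (discrete_inner N x w f (\<Phi> l)) \<mu> * \<Phi> l y)"

end

theory Submission
  imports Defs
begin

text \<open>Exactness of degree \<open>2 n\<close> makes the basis orthonormal for the discrete inner product, so
  Bessel's inequality bounds the coefficients of the hyperinterpolant by
  \<open>\<langle>f, f\<rangle>\<^sub>N \<le> V \<parallel>f\<parallel>\<^sub>\<infinity>\<^sup>2\<close>; thresholding only shrinks them.  As \<open>L\<close> fixes polynomials of degree
  at most \<open>n\<close>, the error of \<open>L (f + \<epsilon>)\<close> is controlled by that of the best uniform approximation,
  which vanishes by Stone--Weierstrass.  Only finitely many coefficients occur for a given \<open>n\<close>,
  so hard thresholding does nothing once the threshold is small; and since \<open>L (f + \<epsilon>)\<close> tends to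
  \<open>f + \<epsilon>\<close> in mean square, the iterated limit of the error is the mean-square norm of \<open>\<epsilon>\<close>.\<close>

section \<open>Polynomial spaces\<close>

lemma poly_space_subspace: "fun_vs.subspace (poly_space n \<Omega>)"
  unfolding poly_space_def by (rule fun_vs.subspace_span)

lemma poly_space_zero: "(\<lambda>_. 0) \<in> poly_space n \<Omega>"
  using fun_vs.subspace_0[OF poly_space_subspace[of n \<Omega>]] by (simp add: zero_fun_def)

lemma poly_space_add:
  "p \<in> poly_space n \<Omega> \<Longrightarrow> q \<in> poly_space n \<Omega> \<Longrightarrow> (\<lambda>x. p x + q x) \<in> poly_space n \<Omega>"
  using fun_vs.subspace_add[OF poly_space_subspace[of n \<Omega>]] by (simp add: plus_fun_def)

lemma poly_space_scale:
  "p \<in> poly_space n \<Omega> \<Longrightarrow> (\<lambda>x. c * p x) \<in> poly_space n \<Omega>"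
  using fun_vs.subspace_scale[OF poly_space_subspace[of n \<Omega>]] by simp

lemma poly_space_sum:
  assumes "\<And>i. i \<in> I \<Longrightarrow> p i \<in> poly_space n \<Omega>"
  shows "(\<lambda>x. \<Sum>i\<in>I. p i x) \<in> poly_space n \<Omega>"
  using assms
  by (induction I rule: infinite_finite_induct) (auto simp: poly_space_zero poly_space_add)

lemma monomial_on_in_poly_space:
  "(\<Sum>i\<in>UNIV. \<alpha> i) \<le> n \<Longrightarrow> monomial_on \<Omega> \<alpha> \<in> poly_space n \<Omega>"
  unfolding poly_space_def by (rule fun_vs.span_base) auto

text \<open>Span induction restated with pointwise lambda-abstractions in place of the
  \<open>0\<close> and \<open>+\<close> of functions, so that each case matches the integrands and
  products that occur later.\<close>

lemma poly_space_induct [consumes 1, case_names zero add scale monomial]: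
  assumes "p \<in> poly_space n \<Omega>"
    and "P (\<lambda>_. 0)"
    and "\<And>p q. P p \<Longrightarrow> P q \<Longrightarrow> P (\<lambda>x. p x + q x)"
    and "\<And>c p. P p \<Longrightarrow> P (\<lambda>x. c * p x)"
    and "\<And>\<alpha>. (\<Sum>i\<in>UNIV. \<alpha> i) \<le> n \<Longrightarrow> P (monomial_on \<Omega> \<alpha>)"
  shows "P p"
proof -
  have "fun_vs.subspace (Collect P)"
    using assms(2-4) unfolding fun_vs.subspace_def
    by (simp add: zero_fun_def plus_fun_def)
  with assms(1,5) show ?thesis
    unfolding poly_space_def by (auto elim!: fun_vs.span_induct)
qed

lemma poly_space_mono:
  assumes "m \<le> n" shows "poly_space m \<Omega> \<subseteq> poly_space n \<Omega>"
  unfolding poly_space_def using assms by (intro fun_vs.span_mono image_mono) auto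

lemma continuous_on_monomial_on: "continuous_on \<Omega> (monomial_on \<Omega> \<alpha>)"
proof -
  have "continuous_on \<Omega> (\<lambda>x. \<Prod>i\<in>UNIV. (x $ i) ^ \<alpha> i)"
    by (intro continuous_intros)
  then show ?thesis
    by (rule continuous_on_eq) (simp add: monomial_on_def)
qed

lemma continuous_on_poly_space:
  "p \<in> poly_space n \<Omega> \<Longrightarrow> continuous_on \<Omega> p"
  by (induction rule: poly_space_induct) (auto intro!: continuous_intros continuous_on_monomial_on)

text \<open>Monomials multiply by adding exponents, so total degrees add. The zero extension is
  harmless, because both sides vanish off \<open>\<Omega>\<close>. Bilinearity then handles one
  factor here and the other in \<open>poly_space_mult\<close>.\<close>

lemma poly_space_mult_monomial:
  assumes "p \<in> poly_space m \<Omega>" "(\<Sum>i\<in>UNIV. \<beta> i) \<le> n"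
  shows "(\<lambda>x. p x * monomial_on \<Omega> \<beta> x) \<in> poly_space (m + n) \<Omega>"
  using assms(1)
proof (induction rule: poly_space_induct)
  case (monomial \<alpha>)
  have "(\<lambda>x. monomial_on \<Omega> \<alpha> x * monomial_on \<Omega> \<beta> x) = monomial_on \<Omega> (\<lambda>i. \<alpha> i + \<beta> i)"
    by (auto simp: monomial_on_def power_add prod.distrib)
  then show ?case
    using monomial assms(2) by (simp add: monomial_on_in_poly_space sum.distrib)
next
  case (add p q)
  then show ?case using poly_space_add by (fastforce simp: distrib_right)
next
  case (scale c p)
  then show ?case using poly_space_scale[OF scale] by (simp add: mult.assoc)
qed (simp add: poly_space_zero)

lemma poly_space_mult:
  assumes "p \<in> poly_space m \<Omega>" "q \<in> poly_space n \<Omega>"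
  shows "(\<lambda>x. p x * q x) \<in> poly_space (m + n) \<Omega>"
  using assms(2)
proof (induction rule: poly_space_induct)
  case (monomial \<alpha>)
  then show ?case by (rule poly_space_mult_monomial[OF assms(1)])
next
  case (add q r)
  then show ?case using poly_space_add by (fastforce simp: distrib_left)
next
  case (scale c q)
  then show ?case using poly_space_scale[OF scale] by (simp add: mult.left_commute)
qed (simp add: poly_space_zero)

section \<open>Polynomial functions restricted to the domain\<close>

lemma poly_space_const: "(\<lambda>x. if x \<in> \<Omega> then c else 0) \<in> poly_space n \<Omega>"
proof -
  have "(\<lambda>x. if x \<in> \<Omega> then c else 0) = (\<lambda>x. c * monomial_on \<Omega> (\<lambda>_. 0) x)"
    by (auto simp: monomial_on_def)
  then show ?thesis by (simp add: poly_space_scale monomial_on_in_poly_space)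
qed

lemma poly_space_coord:
  fixes i :: "'s::finite"
  shows "(\<lambda>x. if x \<in> \<Omega> then x $ i else 0) \<in> poly_space 1 \<Omega>"
proof -
  have "(\<Prod>j\<in>UNIV. (x $ j) ^ (if j = i then 1 else 0)) = x $ i" for x :: "real ^ 's"
    by (subst prod.cong[OF refl, where h = "\<lambda>j. if j = i then x $ i else 1"]) auto
  then have "(\<lambda>x. if x \<in> \<Omega> then x $ i else 0) = monomial_on \<Omega> (\<lambda>j. if j = i then 1 else 0)"
    by (auto simp: monomial_on_def fun_eq_iff)
  then show ?thesis by (simp add: monomial_on_in_poly_space)
qed

text \<open>The bridge to Stone-Weierstrass, which yields a polynomial function on the whole space.
  Cutting it off outside \<open>\<Omega>\<close> puts it into some \<open>poly_space\<close>. Only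
  the existence of a degree matters for a limit in \<open>n\<close>.\<close>

lemma real_polynomial_function_in_poly_space:
  assumes "real_polynomial_function p"
  shows "\<exists>n. (\<lambda>x. if x \<in> \<Omega> then p x else 0) \<in> poly_space n \<Omega>"
  using assms
proof (induction rule: real_polynomial_function.induct)
  case (linear h)
  interpret bounded_linear h by (rule linear)
  \<comment> \<open>A linear functional is determined by its values on the standard basis, hence is
    a combination of coordinate functions.\<close>
  have h: "h x = (\<Sum>i\<in>UNIV. h (axis i 1) * x $ i)" for x
  proof -
    have "h x = h (\<Sum>i\<in>UNIV. (x $ i) *\<^sub>R axis i 1)"
      by (metis basis_expansion scalar_mult_eq_scaleR)
    then show ?thesis by (simp add: sum scale mult.commute)
  qed
  have "(\<lambda>x. if x \<in> \<Omega> then h x else 0)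
      = (\<lambda>x. \<Sum>i\<in>UNIV. h (axis i 1) * (if x \<in> \<Omega> then x $ i else 0))"
  proof
    show "(if x \<in> \<Omega> then h x else 0)
        = (\<Sum>i\<in>UNIV. h (axis i 1) * (if x \<in> \<Omega> then x $ i else 0))" for x
      using h[of x] by simp
  qed
  then have "(\<lambda>x. if x \<in> \<Omega> then h x else 0) \<in> poly_space 1 \<Omega>"
    by (simp only:) (intro poly_space_sum poly_space_scale poly_space_coord)
  then show ?case ..
next
  case (const c)
  then show ?case using poly_space_const by blast
next
  case (add g h)
  then obtain m n where "(\<lambda>x. if x \<in> \<Omega> then g x else 0) \<in> poly_space m \<Omega>"
    "(\<lambda>x. if x \<in> \<Omega> then h x else 0) \<in> poly_space n \<Omega>" by blast
  then have "(\<lambda>x. (if x \<in> \<Omega> then g x else 0) + (if x \<in> \<Omega> then h x else 0))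
      \<in> poly_space (max m n) \<Omega>"
    using poly_space_mono[of m "max m n" \<Omega>] poly_space_mono[of n "max m n" \<Omega>]
    by (intro poly_space_add) auto
  moreover have "(\<lambda>x. (if x \<in> \<Omega> then g x else 0) + (if x \<in> \<Omega> then h x else 0))
      = (\<lambda>x. if x \<in> \<Omega> then g x + h x else 0)" by auto
  ultimately show ?case by auto
next
  case (mult g h)
  then obtain m n where "(\<lambda>x. if x \<in> \<Omega> then g x else 0) \<in> poly_space m \<Omega>"
    "(\<lambda>x. if x \<in> \<Omega> then h x else 0) \<in> poly_space n \<Omega>" by blast
  then have "(\<lambda>x. (if x \<in> \<Omega> then g x else 0) * (if x \<in> \<Omega> then h x else 0))
      \<in> poly_space (m + n) \<Omega>"
    by (rule poly_space_mult)
  moreover have "(\<lambda>x. (if x \<in> \<Omega> then g x else 0) * (if x \<in> \<Omega> then h x else 0))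
      = (\<lambda>x. if x \<in> \<Omega> then g x * h x else 0)" by auto
  ultimately show ?case by auto
qed

section \<open>Uniform and mean-square norms\<close>

lemma abs_le_sup_norm:
  assumes "compact \<Omega>" "continuous_on \<Omega> g" "x \<in> \<Omega>"
  shows "\<bar>g x\<bar> \<le> sup_norm \<Omega> g"
proof -
  have "compact ((\<lambda>x. \<bar>g x\<bar>) ` \<Omega>)"
    using assms by (intro compact_continuous_image continuous_intros)
  then show ?thesis
    unfolding sup_norm_def
    using assms(3) by (intro cSUP_upper bounded_imp_bdd_above compact_imp_bounded)
qed

lemma sup_norm_le:
  assumes "\<Omega> \<noteq> {}" "\<And>x. x \<in> \<Omega> \<Longrightarrow> \<bar>g x\<bar> \<le> B"
  shows "sup_norm \<Omega> g \<le> B"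
  unfolding sup_norm_def using assms by (rule cSUP_least)

lemma sup_norm_nonneg:
  assumes "compact \<Omega>" "\<Omega> \<noteq> {}" "continuous_on \<Omega> g"
  shows "0 \<le> sup_norm \<Omega> g"
  using abs_le_sup_norm[OF assms(1,3)] assms(2) by fastforce

lemma sup_norm_add_le:
  assumes "compact \<Omega>" "\<Omega> \<noteq> {}" "continuous_on \<Omega> g" "continuous_on \<Omega> h"
  shows "sup_norm \<Omega> (\<lambda>x. g x + h x) \<le> sup_norm \<Omega> g + sup_norm \<Omega> h"
  using abs_le_sup_norm[OF assms(1,3)] abs_le_sup_norm[OF assms(1,4)]
  by (intro sup_norm_le assms(2) order_trans[OF abs_triangle_ineq] add_mono)

section \<open>Best uniform approximation\<close>

lemma best_approx_error_nonneg:
  assumes "compact \<Omega>" "\<Omega> \<noteq> {}" "continuous_on \<Omega> g"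
  shows "0 \<le> best_approx_error n \<Omega> g"
  unfolding best_approx_error_def using poly_space_zero
  by (intro cINF_greatest sup_norm_nonneg assms continuous_on_diff continuous_on_poly_space) auto

lemma best_approx_error_le:
  assumes "compact \<Omega>" "\<Omega> \<noteq> {}" "continuous_on \<Omega> g" "p \<in> poly_space n \<Omega>"
  shows "best_approx_error n \<Omega> g \<le> sup_norm \<Omega> (\<lambda>x. g x - p x)"
  unfolding best_approx_error_def
proof (intro cINF_lower assms(4) bdd_belowI2[where m = 0])
  show "0 \<le> sup_norm \<Omega> (\<lambda>x. g x - q x)" if "q \<in> poly_space n \<Omega>" for q
    using that by (intro sup_norm_nonneg assms continuous_on_diff continuous_on_poly_space)
qed

lemma best_approx_error_greatest:
  assumes "\<And>p. p \<in> poly_space n \<Omega> \<Longrightarrow> B \<le> sup_norm \<Omega> (\<lambda>x. g x - p x)"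
  shows "B \<le> best_approx_error n \<Omega> g"
  unfolding best_approx_error_def using poly_space_zero assms by (intro cINF_greatest) auto

text \<open>Stone-Weierstrass supplies one good polynomial, of some degree \<open>m\<close>. Since
  the spaces are nested, it remains a competitor for every \<open>n\<close> above
  \<open>m\<close>.\<close>

lemma best_approx_error_tendsto_0:
  assumes "compact \<Omega>" "\<Omega> \<noteq> {}" "continuous_on \<Omega> g"
  shows "(\<lambda>n. best_approx_error n \<Omega> g) \<longlonglongrightarrow> 0"
proof (rule LIMSEQ_I)
  fix r :: real assume "0 < r"
  \<comment> \<open>A pointwise strict bound gives only a non-strict bound on the supremum; aiming
    at \<open>r / 2\<close> restores strictness.\<close>
  then obtain p where p: "real_polynomial_function p" "\<And>x. x \<in> \<Omega> \<Longrightarrow> \<bar>g x - p x\<bar> < r / 2"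
    using Stone_Weierstrass_real_polynomial_function[OF assms(1,3), of "r / 2"] by auto
  define q where "q = (\<lambda>x. if x \<in> \<Omega> then p x else 0)"
  obtain m where m: "q \<in> poly_space m \<Omega>"
    using real_polynomial_function_in_poly_space[OF p(1)] unfolding q_def by blast
  have "norm (best_approx_error n \<Omega> g - 0) < r" if "m \<le> n" for n
  proof -
    have "best_approx_error n \<Omega> g \<le> sup_norm \<Omega> (\<lambda>x. g x - q x)"
      using poly_space_mono[OF that] m by (intro best_approx_error_le assms) auto
    also have "\<dots> \<le> r / 2"
      using p(2) by (intro sup_norm_le assms(2)) (auto simp: q_def less_imp_le)
    finally show ?thesis
      using best_approx_error_nonneg[OF assms, of n] \<open>0 < r\<close> by simp
  qed
  then show "\<exists>m. \<forall>n\<ge>m. norm (best_approx_error n \<Omega> g - 0) < r" by blast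
qed

section \<open>Mean-square geometry on a compact domain of finite measure\<close>

locale compact_domain =
  fixes \<Omega> :: "(real ^ 's) set" and M :: "(real ^ 's) measure"
  assumes compact: "compact \<Omega>" and nonempty: "\<Omega> \<noteq> {}"
    and finite: "finite_measure M" and space: "space M = \<Omega>"
    and sets: "sets M = sets (restrict_space borel \<Omega>)"
begin

abbreviation V :: real where "V \<equiv> measure M \<Omega>"

lemma integrable_continuous:
  fixes g :: "real ^ 's \<Rightarrow> real"
  assumes "continuous_on \<Omega> g" shows "integrable M g"
proof -
  interpret finite_measure M by (rule finite)
  have "g \<in> borel_measurable M"
    using borel_measurable_continuous_on_restrict[OF assms]
    by (simp add: measurable_cong_sets[OF sets refl])
  then show ?thesis
    using abs_le_sup_norm[OF compact assms]
    by (intro integrable_const_bound[where B = "sup_norm \<Omega> g"] AE_I2) (auto simp: space)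
qed

text \<open>Two separate families are allowed because the lemma serves twice: with a singleton on
  the right it extracts one coefficient, with equal families it gives Parseval's identity.\<close>

lemma L2_inner_sum_sum:
  assumes "\<And>i. i \<in> I \<Longrightarrow> continuous_on \<Omega> (g i)" "\<And>j. j \<in> J \<Longrightarrow> continuous_on \<Omega> (h j)"
  shows "L2_inner M (\<lambda>y. \<Sum>i\<in>I. a i * g i y) (\<lambda>y. \<Sum>j\<in>J. b j * h j y)
    = (\<Sum>i\<in>I. \<Sum>j\<in>J. a i * b j * L2_inner M (g i) (h j))"
proof -
  have int: "integrable M (\<lambda>y. a i * b j * (g i y * h j y))" if "i \<in> I" "j \<in> J" for i j
    using that by (intro integrable_continuous continuous_intros assms)
  have "L2_inner M (\<lambda>y. \<Sum>i\<in>I. a i * g i y) (\<lambda>y. \<Sum>j\<in>J. b j * h j y)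
    = (\<integral>y. (\<Sum>i\<in>I. \<Sum>j\<in>J. a i * b j * (g i y * h j y)) \<partial>M)"
    unfolding L2_inner_def sum_product
    by (intro Bochner_Integration.integral_cong sum.cong refl) (simp only: mult_ac)
  also have "\<dots> = (\<Sum>i\<in>I. \<Sum>j\<in>J. \<integral>y. a i * b j * (g i y * h j y) \<partial>M)"
    using int by (simp add: Bochner_Integration.integral_sum Bochner_Integration.integrable_sum
        del: integral_mult_right_zero Bochner_Integration.integrable_mult_right_iff)
  finally show ?thesis by (simp add: L2_inner_def)
qed

lemma L2_inner_self_nonneg: "0 \<le> L2_inner M g g"
  unfolding L2_inner_def by (rule Bochner_Integration.integral_nonneg) simp

lemma L2_norm_nonneg: "0 \<le> L2_norm M g"
  unfolding L2_norm_def by (simp add: L2_inner_self_nonneg)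

lemma L2_norm_power2: "(L2_norm M g)\<^sup>2 = L2_inner M g g"
  unfolding L2_norm_def by (simp add: L2_inner_self_nonneg)

lemma L2_inner_combination:
  assumes "continuous_on \<Omega> g" "continuous_on \<Omega> h"
  shows "L2_inner M (\<lambda>y. s * g y + t * h y) (\<lambda>y. s * g y + t * h y)
    = s\<^sup>2 * L2_inner M g g + 2 * s * t * L2_inner M g h + t\<^sup>2 * L2_inner M h h"
proof -
  have "(\<lambda>y. (s * g y + t * h y) * (s * g y + t * h y))
    = (\<lambda>y. s\<^sup>2 * (g y * g y) + 2 * s * t * (g y * h y) + t\<^sup>2 * (h y * h y))"
    by (auto simp: algebra_simps power2_eq_square)
  moreover have "integrable M (\<lambda>y. s\<^sup>2 * (g y * g y))" "integrable M (\<lambda>y. 2 * s * t * (g y * h y))"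
      "integrable M (\<lambda>y. t\<^sup>2 * (h y * h y))"
    by (intro integrable_continuous continuous_intros assms)+
  ultimately show ?thesis
    unfolding L2_inner_def by simp
qed

text \<open>The quadratic form of \<open>L2_inner_combination\<close> is nonnegative for all
  \<open>s\<close> and \<open>t\<close>. The form may be degenerate, since a nonzero continuous
  function can vanish almost everywhere, so \<open>C = 0\<close> is a case of its own.\<close>

lemma L2_inner_Cauchy_Schwarz:
  assumes "continuous_on \<Omega> g" "continuous_on \<Omega> h"
  shows "L2_inner M g h \<le> L2_norm M g * L2_norm M h"
proof -
  define A B C where "A = L2_inner M g g" "B = L2_inner M g h" "C = L2_inner M h h"
  have quad: "0 \<le> s\<^sup>2 * A + 2 * s * t * B + t\<^sup>2 * C" for s t
    using L2_inner_self_nonneg[of "\<lambda>y. s * g y + t * h y"]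
    unfolding L2_inner_combination[OF assms] A_B_C_def .
  have "0 \<le> C" unfolding A_B_C_def by (rule L2_inner_self_nonneg)
  have "B\<^sup>2 \<le> A * C"
  proof (cases "C = 0")
    case True
    have "B = 0"
    proof (rule ccontr)
      assume "B \<noteq> 0"
      \<comment> \<open>With \<open>C = 0\<close> the form at \<open>s = 1\<close> is
        \<open>A + 2 * t * B\<close>, and this \<open>t\<close> makes it equal to -1.\<close>
      then show False using quad[of 1 "- (A + 1) / (2 * B)"] quad[of 1 0] True
        by (simp add: field_simps)
    qed
    then show ?thesis using True by simp
  next
    case False
    \<comment> \<open>At \<open>s = C\<close>, \<open>t = - B\<close> the form factors as
      \<open>C * (A * C - B\<^sup>2)\<close>.\<close>
    have "0 \<le> C * (A * C - B\<^sup>2)"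
      using quad[of C "- B"] by (simp add: algebra_simps power2_eq_square)
    then show ?thesis using False \<open>0 \<le> C\<close> by (simp add: zero_le_mult_iff)
  qed
  then have "B \<le> sqrt (A * C)" by (rule real_le_rsqrt)
  then show ?thesis by (simp add: L2_norm_def A_B_C_def real_sqrt_mult)
qed

lemma L2_norm_triangle:
  assumes "continuous_on \<Omega> g" "continuous_on \<Omega> h"
  shows "L2_norm M (\<lambda>y. g y + h y) \<le> L2_norm M g + L2_norm M h"
proof (rule power2_le_imp_le)
  have "(L2_norm M (\<lambda>y. g y + h y))\<^sup>2
      = (L2_norm M g)\<^sup>2 + 2 * L2_inner M g h + (L2_norm M h)\<^sup>2"
    using L2_inner_combination[OF assms, of 1 1] by (simp add: L2_norm_power2)
  also have "\<dots> \<le> (L2_norm M g + L2_norm M h)\<^sup>2"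
    using L2_inner_Cauchy_Schwarz[OF assms] by (simp add: power2_sum)
  finally show "(L2_norm M (\<lambda>y. g y + h y))\<^sup>2 \<le> (L2_norm M g + L2_norm M h)\<^sup>2" .
qed (simp add: L2_norm_nonneg)

lemma L2_norm_minus: "L2_norm M (\<lambda>y. - g y) = L2_norm M g"
  by (simp add: L2_norm_def L2_inner_def)

lemma L2_norm_diff_abs:
  assumes "continuous_on \<Omega> g" "continuous_on \<Omega> h"
  shows "\<bar>L2_norm M g - L2_norm M h\<bar> \<le> L2_norm M (\<lambda>y. g y - h y)"
proof -
  have "L2_norm M g \<le> L2_norm M (\<lambda>y. g y - h y) + L2_norm M h"
    using L2_norm_triangle[of "\<lambda>y. g y - h y" h] assms by (simp add: continuous_on_diff)
  moreover have "L2_norm M h \<le> L2_norm M (\<lambda>y. h y - g y) + L2_norm M g"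
    using L2_norm_triangle[of "\<lambda>y. h y - g y" g] assms by (simp add: continuous_on_diff)
  moreover have "L2_norm M (\<lambda>y. h y - g y) = L2_norm M (\<lambda>y. g y - h y)"
    using L2_norm_minus[of "\<lambda>y. g y - h y"] by simp
  ultimately show ?thesis by linarith
qed

lemma L2_norm_le_sup_norm:
  assumes "continuous_on \<Omega> g"
  shows "L2_norm M g \<le> sqrt V * sup_norm \<Omega> g"
proof -
  interpret finite_measure M by (rule finite)
  have "L2_inner M g g \<le> (\<integral>y. (sup_norm \<Omega> g)\<^sup>2 \<partial>M)"
    unfolding L2_inner_def
  proof (rule integral_mono)
    show "integrable M (\<lambda>y. g y * g y)"
      by (intro integrable_continuous continuous_intros assms)
    show "g y * g y \<le> (sup_norm \<Omega> g)\<^sup>2" if "y \<in> space M" for y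
    proof -
      have "\<bar>g y\<bar>\<^sup>2 \<le> (sup_norm \<Omega> g)\<^sup>2"
        using that abs_le_sup_norm[OF compact assms] by (intro power_mono) (auto simp: space)
      then show ?thesis by (simp add: power2_eq_square)
    qed
  qed simp
  also have "\<dots> = V * (sup_norm \<Omega> g)\<^sup>2" by (simp add: space)
  finally have "L2_norm M g \<le> sqrt (V * (sup_norm \<Omega> g)\<^sup>2)"
    unfolding L2_norm_def by (rule real_sqrt_le_mono)
  then show ?thesis
    using sup_norm_nonneg[OF compact nonempty assms] by (simp add: real_sqrt_mult)
qed

end

section \<open>Hyperinterpolation\<close>

locale hyperinterpolation = compact_domain \<Omega> M
  for \<Omega> :: "(real ^ 's) set" and M :: "(real ^ 's) measure" +
  fixes n N :: nat and x :: "nat \<Rightarrow> real ^ 's" and w :: "nat \<Rightarrow> real"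
    and \<Phi> :: "nat \<Rightarrow> real ^ 's \<Rightarrow> real"
  assumes basis: "orthonormal_basis n \<Omega> M \<Phi>"
    and quadrature: "quadrature_rule (2 * n) \<Omega> M N x w"
begin

abbreviation dm :: nat where "dm \<equiv> poly_dim n \<Omega>"
abbreviation L :: "(real ^ 's \<Rightarrow> real) \<Rightarrow> real ^ 's \<Rightarrow> real"
  where "L \<equiv> hyperinterp dm N x w \<Phi>"
abbreviation H :: "real \<Rightarrow> (real ^ 's \<Rightarrow> real) \<Rightarrow> real ^ 's \<Rightarrow> real"
  where "H \<equiv> hard_hyperinterp dm N x w \<Phi>"

lemma node: "j \<in> {1..N} \<Longrightarrow> x j \<in> \<Omega>" and weight_pos: "j \<in> {1..N} \<Longrightarrow> 0 < w j"
  using quadrature by (auto simp: quadrature_rule_def)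

lemma basis_in_poly_space: "l \<in> {1..dm} \<Longrightarrow> \<Phi> l \<in> poly_space n \<Omega>"
  using basis unfolding orthonormal_basis_def by (metis fun_vs.span_base image_eqI)

lemma L2_inner_basis:
  "k \<in> {1..dm} \<Longrightarrow> l \<in> {1..dm} \<Longrightarrow> L2_inner M (\<Phi> k) (\<Phi> l) = (if k = l then 1 else 0)"
  using basis unfolding orthonormal_basis_def by blast

lemma continuous_on_basis: "l \<in> {1..dm} \<Longrightarrow> continuous_on \<Omega> (\<Phi> l)"
  using basis_in_poly_space continuous_on_poly_space by blast

lemma continuous_on_hyperinterp: "continuous_on \<Omega> (L g)"
  unfolding hyperinterp_def by (intro continuous_intros continuous_on_basis)

lemma continuous_on_hard_hyperinterp: "continuous_on \<Omega> (H \<mu> g)"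
  unfolding hard_hyperinterp_def by (intro continuous_intros continuous_on_basis)

text \<open>The product of two polynomials of degree at most \<open>n\<close> has degree at most
  \<open>2 * n\<close>, exactly where the quadrature rule is exact.\<close>

lemma discrete_inner_eq_L2_inner:
  assumes "p \<in> poly_space n \<Omega>" "q \<in> poly_space n \<Omega>"
  shows "discrete_inner N x w p q = L2_inner M p q"
  using quadrature poly_space_mult[OF assms]
  by (simp add: quadrature_rule_def discrete_inner_def L2_inner_def mult_2 mult.assoc)

text \<open>Exactness on the constant 1, represented in \<open>poly_space\<close> by the indicator
  of \<open>\<Omega>\<close>; it equals 1 at every node and on all of
  \<open>space M\<close>.\<close>

lemma sum_weights: "(\<Sum>j=1..N. w j) = V"
proof -
  have "(\<integral>y. (if y \<in> \<Omega> then 1 else 0 :: real) \<partial>M)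
      = (\<Sum>j=1..N. w j * (if x j \<in> \<Omega> then 1 else 0))"
    using quadrature poly_space_const[of \<Omega> 1 "2 * n"] by (simp add: quadrature_rule_def)
  also have "\<dots> = (\<Sum>j=1..N. w j)" by (rule sum.cong) (auto simp: node)
  also have "(\<integral>y. (if y \<in> \<Omega> then 1 else 0 :: real) \<partial>M) = (\<integral>y. 1 \<partial>M)"
    by (rule Bochner_Integration.integral_cong) (auto simp: space)
  finally show ?thesis by (simp add: space)
qed

text \<open>The span is taken over an image set, while the coefficients are needed by index. The
  indexed combinations form a subspace containing every basis function, hence the whole
  span.\<close>

lemma basis_expansion:
  assumes "p \<in> poly_space n \<Omega>"
  obtains c where "p = (\<lambda>y. \<Sum>l=1..dm. c l * \<Phi> l y)"
proof -
  define S where "S = {p. \<exists>c. p = (\<lambda>y. \<Sum>l=1..dm. c l * \<Phi> l y)}"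
  have "fun_vs.subspace S"
    unfolding fun_vs.subspace_def
  proof (intro conjI ballI allI)
    show "0 \<in> S"
      unfolding S_def by (auto simp: fun_eq_iff intro!: exI[of _ "\<lambda>_. 0"])
    show "p + q \<in> S" if "p \<in> S" "q \<in> S" for p q
    proof -
      from that obtain a b where "p = (\<lambda>y. \<Sum>l=1..dm. a l * \<Phi> l y)"
        "q = (\<lambda>y. \<Sum>l=1..dm. b l * \<Phi> l y)" unfolding S_def by auto
      then have "p + q = (\<lambda>y. \<Sum>l=1..dm. (a l + b l) * \<Phi> l y)"
        by (auto simp: fun_eq_iff distrib_right sum.distrib)
      then show ?thesis unfolding S_def by (intro CollectI exI)
    qed
    show "(\<lambda>y. c * p y) \<in> S" if "p \<in> S" for c p
    proof -
      from that obtain a where "p = (\<lambda>y. \<Sum>l=1..dm. a l * \<Phi> l y)" unfolding S_def by auto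
      then have "(\<lambda>y. c * p y) = (\<lambda>y. \<Sum>l=1..dm. (c * a l) * \<Phi> l y)"
        by (auto simp: fun_eq_iff sum_distrib_left mult.assoc)
      then show ?thesis unfolding S_def by (intro CollectI exI)
    qed
  qed
  moreover have "\<Phi> k \<in> S" if "k \<in> {1..dm}" for k
  proof -
    have "\<Phi> k = (\<lambda>y. \<Sum>l=1..dm. (if l = k then 1 else 0) * \<Phi> l y)"
      using that by (auto simp: fun_eq_iff if_distrib[of "\<lambda>c. c * _"] cong: if_cong)
    then show ?thesis unfolding S_def by (intro CollectI exI)
  qed
  ultimately have "fun_vs.span (\<Phi> ` {1..dm}) \<subseteq> S"
    by (intro fun_vs.span_minimal) auto
  then have "p \<in> S"
    using assms basis unfolding orthonormal_basis_def by auto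
  then show thesis using that unfolding S_def by auto
qed

text \<open>For a polynomial the discrete coefficients are the true \<open>L2_inner\<close>
  coefficients, and orthonormality returns the coefficients of its expansion.\<close>

lemma hyperinterp_poly:
  assumes "p \<in> poly_space n \<Omega>" shows "L p = p"
proof -
  obtain c where p: "p = (\<lambda>y. \<Sum>l=1..dm. c l * \<Phi> l y)" using basis_expansion[OF assms] .
  have "discrete_inner N x w p (\<Phi> l) = c l" if l: "l \<in> {1..dm}" for l
  proof -
    have "discrete_inner N x w p (\<Phi> l) = L2_inner M p (\<Phi> l)"
      using assms l by (intro discrete_inner_eq_L2_inner basis_in_poly_space)
    also have "\<dots> = (\<Sum>k=1..dm. c k * L2_inner M (\<Phi> k) (\<Phi> l))"
      unfolding p using L2_inner_sum_sum[of "{1..dm}" \<Phi> "{l}" \<Phi> c "\<lambda>_. 1"] l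
      by (simp add: continuous_on_basis)
    also have "\<dots> = (\<Sum>k=1..dm. if k = l then c k else 0)"
      using l by (intro sum.cong) (auto simp: L2_inner_basis)
    finally show ?thesis using l by simp
  qed
  then show ?thesis
    by (subst (2) p) (auto simp: hyperinterp_def fun_eq_iff intro!: sum.cong)
qed

lemma hyperinterp_add: "L (\<lambda>y. g y + h y) y = L g y + L h y"
  by (simp add: hyperinterp_def discrete_inner_def distrib_left distrib_right sum.distrib)

section \<open>Parseval, discrete Bessel and mean-square stability\<close>

lemma L2_inner_combination_basis:
  "L2_inner M (\<lambda>y. \<Sum>l=1..dm. a l * \<Phi> l y) (\<lambda>y. \<Sum>l=1..dm. a l * \<Phi> l y) = (\<Sum>l=1..dm. (a l)\<^sup>2)"
proof -
  have "L2_inner M (\<lambda>y. \<Sum>l=1..dm. a l * \<Phi> l y) (\<lambda>y. \<Sum>l=1..dm. a l * \<Phi> l y)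
      = (\<Sum>k=1..dm. \<Sum>l=1..dm. a k * a l * L2_inner M (\<Phi> k) (\<Phi> l))"
    by (rule L2_inner_sum_sum) (auto intro: continuous_on_basis)
  also have "\<dots> = (\<Sum>k=1..dm. \<Sum>l=1..dm. if k = l then a k * a l else 0)"
    by (intro sum.cong refl) (auto simp: L2_inner_basis)
  also have "\<dots> = (\<Sum>k=1..dm. (a k)\<^sup>2)"
    by (intro sum.cong refl) (auto simp: power2_eq_square)
  finally show ?thesis .
qed

text \<open>The residual \<open>g - L g\<close> has nonnegative discrete square. Both
  \<open>\<langle>g, L g\<rangle>\<close> and \<open>\<langle>L g, L g\<rangle>\<close> equal the
  sum of squared coefficients: the first by the definition of \<open>L\<close>, the second by
  exactness and Parseval.\<close>

lemma discrete_Bessel: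
  "(\<Sum>l=1..dm. (discrete_inner N x w g (\<Phi> l))\<^sup>2) \<le> discrete_inner N x w g g"
proof -
  let ?a = "\<lambda>l. discrete_inner N x w g (\<Phi> l)"
  let ?q = "L g"
  have q: "L g = (\<lambda>y. \<Sum>l=1..dm. ?a l * \<Phi> l y)" by (simp add: hyperinterp_def fun_eq_iff)
  have "?q \<in> poly_space n \<Omega>"
    unfolding q by (intro poly_space_sum poly_space_scale basis_in_poly_space)
  then have qq: "discrete_inner N x w ?q ?q = (\<Sum>l=1..dm. (?a l)\<^sup>2)"
    using L2_inner_combination_basis[of ?a]
    by (simp only: discrete_inner_eq_L2_inner q)
  have "discrete_inner N x w g ?q = (\<Sum>j=1..N. \<Sum>l=1..dm. ?a l * (w j * g (x j) * \<Phi> l (x j)))"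
    unfolding q by (subst discrete_inner_def) (simp only: sum_distrib_left mult_ac)
  also have "\<dots> = (\<Sum>l=1..dm. \<Sum>j=1..N. ?a l * (w j * g (x j) * \<Phi> l (x j)))"
    by (rule sum.swap)
  also have "\<dots> = (\<Sum>l=1..dm. ?a l * ?a l)"
    by (intro sum.cong refl) (simp add: discrete_inner_def[of N x w g "\<Phi> _"] sum_distrib_left[symmetric])
  finally have gq: "discrete_inner N x w g ?q = (\<Sum>l=1..dm. (?a l)\<^sup>2)"
    by (simp add: power2_eq_square)
  have "0 \<le> (\<Sum>j=1..N. w j * (g (x j) - ?q (x j))\<^sup>2)"
    by (intro sum_nonneg mult_nonneg_nonneg) (auto simp: weight_pos less_imp_le)
  also have "\<dots> = discrete_inner N x w g g - 2 * discrete_inner N x w g ?q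
      + discrete_inner N x w ?q ?q"
    unfolding discrete_inner_def[of _ _ _ g g] discrete_inner_def[of _ _ _ g ?q]
      discrete_inner_def[of _ _ _ ?q ?q] sum_distrib_left
      sum_subtractf[symmetric] sum.distrib[symmetric]
    by (intro sum.cong refl) (simp add: power2_eq_square algebra_simps)
  finally show ?thesis using qq gq by simp
qed

lemma discrete_inner_self_le:
  assumes "continuous_on \<Omega> g"
  shows "discrete_inner N x w g g \<le> V * (sup_norm \<Omega> g)\<^sup>2"
proof -
  have "discrete_inner N x w g g \<le> (\<Sum>j=1..N. w j * (sup_norm \<Omega> g)\<^sup>2)"
    unfolding discrete_inner_def
  proof (rule sum_mono)
    fix j assume j: "j \<in> {1..N}"
    have "\<bar>g (x j)\<bar>\<^sup>2 \<le> (sup_norm \<Omega> g)\<^sup>2"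
      using abs_le_sup_norm[OF compact assms node[OF j]] by (intro power_mono) auto
    then show "w j * g (x j) * g (x j) \<le> w j * (sup_norm \<Omega> g)\<^sup>2"
      using weight_pos[OF j] by (simp add: power2_eq_square mult.assoc)
  qed
  also have "\<dots> = V * (sup_norm \<Omega> g)\<^sup>2"
    by (simp add: sum_weights[symmetric] sum_distrib_right)
  finally show ?thesis .
qed

text \<open>One estimate for \<open>L\<close> and \<open>H\<close> together: by Parseval,
  coefficients dominated by the discrete ones can only lower the norm.\<close>

lemma L2_norm_shrunk_le:
  assumes "continuous_on \<Omega> g"
    and "\<And>l. \<bar>a l\<bar> \<le> \<bar>discrete_inner N x w g (\<Phi> l)\<bar>"
  shows "L2_norm M (\<lambda>y. \<Sum>l=1..dm. a l * \<Phi> l y) \<le> sqrt V * sup_norm \<Omega> g"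
proof -
  have "(\<Sum>l=1..dm. (a l)\<^sup>2) \<le> (\<Sum>l=1..dm. (discrete_inner N x w g (\<Phi> l))\<^sup>2)"
    using assms(2) by (intro sum_mono) (simp add: abs_le_square_iff)
  also note discrete_Bessel
  also note discrete_inner_self_le[OF assms(1)]
  finally have "L2_norm M (\<lambda>y. \<Sum>l=1..dm. a l * \<Phi> l y) \<le> sqrt (V * (sup_norm \<Omega> g)\<^sup>2)"
    unfolding L2_norm_def L2_inner_combination_basis by (rule real_sqrt_le_mono)
  then show ?thesis
    using sup_norm_nonneg[OF compact nonempty assms(1)] by (simp add: real_sqrt_mult)
qed

lemma L2_norm_hyperinterp_le:
  assumes "continuous_on \<Omega> g" shows "L2_norm M (L g) \<le> sqrt V * sup_norm \<Omega> g"
  using L2_norm_shrunk_le[OF assms, of "\<lambda>l. discrete_inner N x w g (\<Phi> l)"]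
  by (simp add: hyperinterp_def[abs_def])

lemma L2_norm_hard_hyperinterp_le:
  assumes "continuous_on \<Omega> g" shows "L2_norm M (H \<mu> g) \<le> sqrt V * sup_norm \<Omega> g"
  using L2_norm_shrunk_le[OF assms, of "\<lambda>l. hard_threshold (discrete_inner N x w g (\<Phi> l)) \<mu>"]
  by (simp add: hard_hyperinterp_def[abs_def] hard_threshold_def)

section \<open>Error estimates under noise\<close>

lemma L2_norm_hyperinterp_error:
  assumes "continuous_on \<Omega> f" "continuous_on \<Omega> \<epsilon>"
  shows "L2_norm M (\<lambda>y. L (\<lambda>y. f y + \<epsilon> y) y - f y)
    \<le> 2 * sqrt V * best_approx_error n \<Omega> f + sqrt V * sup_norm \<Omega> \<epsilon>"
proof -
  let ?E = "L2_norm M (\<lambda>y. L (\<lambda>y. f y + \<epsilon> y) y - f y)"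
  have *: "?E \<le> 2 * sqrt V * sup_norm \<Omega> (\<lambda>y. f y - p y) + sqrt V * sup_norm \<Omega> \<epsilon>"
    if p: "p \<in> poly_space n \<Omega>" for p
  proof -
    note cont = assms continuous_on_poly_space[OF p]
    define h where "h = (\<lambda>y. f y - p y)"
    have h: "continuous_on \<Omega> h" unfolding h_def by (intro continuous_intros cont)
    \<comment> \<open>Since \<open>L\<close> fixes \<open>p\<close>, the function \<open>f\<close>
      may be replaced by \<open>h = f - p\<close> on both sides of the difference. Stability of
      \<open>L\<close> and the plain norm bound then contribute one
      \<open>sup_norm \<Omega> h\<close> each, whence the factor 2.\<close>
    have "L (\<lambda>y. f y + \<epsilon> y) y - f y = L (\<lambda>y. h y + \<epsilon> y) y + - h y" for y
      using hyperinterp_add[of "\<lambda>y. h y + \<epsilon> y" p y]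
      by (simp add: hyperinterp_poly[OF p] h_def algebra_simps)
    then have "?E = L2_norm M (\<lambda>y. L (\<lambda>y. h y + \<epsilon> y) y + - h y)" by simp
    also have "\<dots> \<le> L2_norm M (L (\<lambda>y. h y + \<epsilon> y)) + L2_norm M h"
      using L2_norm_triangle[of "L (\<lambda>y. h y + \<epsilon> y)" "\<lambda>y. - h y"] h
      by (simp only: L2_norm_minus continuous_on_hyperinterp continuous_on_minus)
    also have "\<dots> \<le> sqrt V * sup_norm \<Omega> (\<lambda>y. h y + \<epsilon> y) + sqrt V * sup_norm \<Omega> h"
      by (intro add_mono L2_norm_hyperinterp_le L2_norm_le_sup_norm continuous_intros h assms)
    also have "\<dots> \<le> sqrt V * (sup_norm \<Omega> h + sup_norm \<Omega> \<epsilon>) + sqrt V * sup_norm \<Omega> h"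
      by (intro add_mono mult_left_mono sup_norm_add_le compact nonempty h assms) auto
    finally show ?thesis by (simp add: h_def algebra_simps)
  qed
  show ?thesis
  \<comment> \<open>The estimate holds for each \<open>p\<close> and must pass to the infimum, which
    is done by solving for \<open>sup_norm \<Omega> (\<lambda>y. f y - p y)\<close> and dividing by
    \<open>2 * sqrt V\<close>. For \<open>V = 0\<close> the estimate with \<open>p = 0\<close>
    already gives the claim.\<close>
  proof (cases "V = 0")
    case True
    then show ?thesis using *[OF poly_space_zero] by simp
  next
    case False
    then have pos: "0 < 2 * sqrt V" by (simp add: zero_less_measure_iff)
    have "(?E - sqrt V * sup_norm \<Omega> \<epsilon>) / (2 * sqrt V) \<le> best_approx_error n \<Omega> f"
    proof (rule best_approx_error_greatest)
      fix p assume "p \<in> poly_space n \<Omega>"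
      then show "(?E - sqrt V * sup_norm \<Omega> \<epsilon>) / (2 * sqrt V) \<le> sup_norm \<Omega> (\<lambda>y. f y - p y)"
        using *[of p] by (subst pos_divide_le_eq[OF pos]) (simp add: algebra_simps)
    qed
    then show ?thesis by (subst (asm) pos_divide_le_eq[OF pos]) (simp add: algebra_simps)
  qed
qed

lemma L2_norm_hard_hyperinterp_error:
  assumes "continuous_on \<Omega> f" "continuous_on \<Omega> \<epsilon>"
  shows "L2_norm M (\<lambda>y. H \<mu> (\<lambda>y. f y + \<epsilon> y) y - f y)
    \<le> L2_norm M (\<lambda>y. H \<mu> (\<lambda>y. f y + \<epsilon> y) y - L (\<lambda>y. f y + \<epsilon> y) y)
      + 2 * sqrt V * best_approx_error n \<Omega> f + sqrt V * sup_norm \<Omega> \<epsilon>"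
proof -
  let ?g = "\<lambda>y. f y + \<epsilon> y"
  have "L2_norm M (\<lambda>y. (H \<mu> ?g y - L ?g y) + (L ?g y - f y))
      \<le> L2_norm M (\<lambda>y. H \<mu> ?g y - L ?g y) + L2_norm M (\<lambda>y. L ?g y - f y)"
    by (intro L2_norm_triangle continuous_intros continuous_on_hyperinterp
        continuous_on_hard_hyperinterp assms)
  then show ?thesis using L2_norm_hyperinterp_error[OF assms] by simp
qed

text \<open>A zero coefficient is fixed by every threshold and a nonzero one by every threshold
  below its modulus. Finitely many such conditions hold simultaneously near 0.\<close>

lemma hard_hyperinterp_eq_hyperinterp: "\<forall>\<^sub>F \<mu> in at_right 0. H \<mu> g = L g"
proof -
  have "\<forall>\<^sub>F \<mu> in at_right 0. hard_threshold a \<mu> = a" for a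
  proof (cases "a = 0")
    case False
    then have "\<forall>\<^sub>F \<mu> in at_right 0. \<mu> < \<bar>a\<bar>"
      by (intro order_tendstoD(2)[OF tendsto_ident_at]) simp
    then show ?thesis by eventually_elim (simp add: hard_threshold_def)
  qed (simp add: hard_threshold_def)
  then have "\<forall>\<^sub>F \<mu> in at_right 0. \<forall>l\<in>{1..dm}.
      hard_threshold (discrete_inner N x w g (\<Phi> l)) \<mu> = discrete_inner N x w g (\<Phi> l)"
    by (intro eventually_ball_finite) auto
  then show ?thesis
    by eventually_elim (simp add: hard_hyperinterp_def hyperinterp_def fun_eq_iff)
qed

end

text \<open>The value \<open>sqrt V * sup_norm \<Omega> \<epsilon>\<close> is the iterated limit of
  \<open>bound\<close>. The error \<open>err\<close> itself has the iterated limit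
  \<open>L2_norm M \<epsilon>\<close>, which is strictly smaller unless the modulus of
  \<open>\<epsilon>\<close> equals its supremum almost everywhere. Hence the limit claim is split
  into two limits and a comparison. The inner limits are one-sided because thresholds are
  positive.\<close>

theorem theorem4p2:
  fixes \<Omega> :: "(real ^ 's) set" and d :: nat
    and M :: "(real ^ 's) measure" and V :: real
    and N :: "nat \<Rightarrow> nat" and x :: "nat \<Rightarrow> nat \<Rightarrow> real ^ 's" and w :: "nat \<Rightarrow> nat \<Rightarrow> real"
    and \<Phi> :: "nat \<Rightarrow> nat \<Rightarrow> real ^ 's \<Rightarrow> real"
    and f \<epsilon> :: "real ^ 's \<Rightarrow> real"
  assumes "compact \<Omega>" and "\<Omega> \<noteq> {}" and "smooth_submanifold d \<Omega>"
    and "finite_measure M" and "space M = \<Omega>" and "sets M = sets (restrict_space borel \<Omega>)"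
    and "V = measure M \<Omega>"
    and "\<And>n. orthonormal_basis n \<Omega> M (\<Phi> n)"
    and "\<And>n. quadrature_rule (2 * n) \<Omega> M (N n) (x n) (w n)"
    and "continuous_on \<Omega> f" and "continuous_on \<Omega> \<epsilon>"
  defines "\<L> \<equiv> \<lambda>n. hyperinterp (poly_dim n \<Omega>) (N n) (x n) (w n) (\<Phi> n)"
    and "\<H> \<equiv> \<lambda>n. hard_hyperinterp (poly_dim n \<Omega>) (N n) (x n) (w n) (\<Phi> n)"
    and "f\<epsilon> \<equiv> \<lambda>y. f y + \<epsilon> y"
  defines "err \<equiv> \<lambda>n \<mu>. L2_norm M (\<lambda>y. \<H> n \<mu> f\<epsilon> y - f y)"
    and "bound \<equiv> \<lambda>n \<mu>. L2_norm M (\<lambda>y. \<H> n \<mu> f\<epsilon> y - \<L> n f\<epsilon> y)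
                  + 2 * sqrt V * best_approx_error n \<Omega> f + sqrt V * sup_norm \<Omega> \<epsilon>"
  shows "(\<forall>n. \<forall>\<mu>>0. L2_norm M (\<H> n \<mu> f) \<le> sqrt V * sup_norm \<Omega> f) \<and>
         (\<forall>n. \<forall>\<mu>>0. err n \<mu> \<le> bound n \<mu>) \<and>
         (\<exists>b. (\<forall>n. (bound n \<longlongrightarrow> b n) (at_right 0)) \<and> b \<longlonglongrightarrow> sqrt V * sup_norm \<Omega> \<epsilon>) \<and>
         (\<exists>e. (\<forall>n. (err n \<longlongrightarrow> e n) (at_right 0)) \<and> e \<longlonglongrightarrow> L2_norm M \<epsilon>) \<and>
         L2_norm M \<epsilon> \<le> sqrt V * sup_norm \<Omega> \<epsilon>"
proof -
  note cont = \<open>continuous_on \<Omega> f\<close> \<open>continuous_on \<Omega> \<epsilon>\<close>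
  have cont_f\<epsilon>: "continuous_on \<Omega> f\<epsilon>"
    unfolding f\<epsilon>_def by (intro continuous_intros cont)
  interpret D: compact_domain \<Omega> M
    by (rule compact_domain.intro) (fact assms)+
  have hyp: "hyperinterpolation \<Omega> M n (N n) (x n) (w n) (\<Phi> n)" for n
    by (intro hyperinterpolation.intro hyperinterpolation_axioms.intro D.compact_domain_axioms)
      (fact assms)+
  have ev: "\<forall>\<^sub>F \<mu> in at_right 0. \<H> n \<mu> f\<epsilon> = \<L> n f\<epsilon>" for n
    unfolding \<H>_def \<L>_def by (rule hyperinterpolation.hard_hyperinterp_eq_hyperinterp[OF hyp])
  have "L2_norm M (\<H> n \<mu> f) \<le> sqrt V * sup_norm \<Omega> f" for n \<mu>
    unfolding \<H>_def \<open>V = _\<close>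
    by (rule hyperinterpolation.L2_norm_hard_hyperinterp_le[OF hyp cont(1)])
  moreover have "err n \<mu> \<le> bound n \<mu>" for n \<mu>
    unfolding err_def bound_def \<H>_def \<L>_def f\<epsilon>_def \<open>V = _\<close>
    by (rule hyperinterpolation.L2_norm_hard_hyperinterp_error[OF hyp cont])
  moreover have "\<exists>b. (\<forall>n. (bound n \<longlongrightarrow> b n) (at_right 0)) \<and> b \<longlonglongrightarrow> sqrt V * sup_norm \<Omega> \<epsilon>"
  proof (intro exI conjI allI)
    let ?b = "\<lambda>n. 2 * sqrt V * best_approx_error n \<Omega> f + sqrt V * sup_norm \<Omega> \<epsilon>"
    \<comment> \<open>Once \<open>\<H>\<close> and \<open>\<L>\<close> agree, the first summand of
      \<open>bound\<close> is the norm of the zero function.\<close>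
    have "\<forall>\<^sub>F \<mu> in at_right 0. bound n \<mu> = ?b n" for n
      using ev[of n] by eventually_elim (simp add: bound_def L2_norm_def L2_inner_def)
    then show "(bound n \<longlongrightarrow> ?b n) (at_right 0)" for n
      by (rule tendsto_eventually)
    have "?b \<longlonglongrightarrow> 2 * sqrt V * 0 + sqrt V * sup_norm \<Omega> \<epsilon>"
      by (intro tendsto_intros best_approx_error_tendsto_0 assms)
    then show "?b \<longlonglongrightarrow> sqrt V * sup_norm \<Omega> \<epsilon>" by simp
  qed
  moreover have "\<exists>e. (\<forall>n. (err n \<longlongrightarrow> e n) (at_right 0)) \<and> e \<longlonglongrightarrow> L2_norm M \<epsilon>"
  proof (intro exI conjI allI)
    let ?e = "\<lambda>n. L2_norm M (\<lambda>y. \<L> n f\<epsilon> y - f y)"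
    have "\<forall>\<^sub>F \<mu> in at_right 0. err n \<mu> = ?e n" for n
      using ev[of n] by eventually_elim (simp add: err_def)
    then show "(err n \<longlongrightarrow> ?e n) (at_right 0)" for n
      by (rule tendsto_eventually)
    \<comment> \<open>The reverse triangle inequality reduces the limit to mean-square convergence
      of \<open>\<L> n f\<epsilon>\<close> to \<open>f\<epsilon>\<close>. This is the error estimate
      with \<open>f\<epsilon>\<close> as the exact function and zero noise, hence the artificial
      \<open>+ 0\<close> below.\<close>
    have le: "norm (?e n - L2_norm M \<epsilon>) \<le> 2 * sqrt V * best_approx_error n \<Omega> f\<epsilon>" for n
    proof -
      interpret hyperinterpolation \<Omega> M n "N n" "x n" "w n" "\<Phi> n" by (rule hyp)
      have "\<bar>?e n - L2_norm M \<epsilon>\<bar> \<le> L2_norm M (\<lambda>y. (\<L> n f\<epsilon> y - f y) - \<epsilon> y)"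
        unfolding \<L>_def
        by (intro D.L2_norm_diff_abs continuous_intros continuous_on_hyperinterp cont)
      also have "\<dots> = L2_norm M (\<lambda>y. \<L> n (\<lambda>y. f\<epsilon> y + 0) y - f\<epsilon> y)"
        by (simp add: f\<epsilon>_def diff_diff_eq)
      also have "\<dots> \<le> 2 * sqrt V * best_approx_error n \<Omega> f\<epsilon> + sqrt V * sup_norm \<Omega> (\<lambda>_. 0)"
        unfolding \<L>_def \<open>V = _\<close>
        by (rule L2_norm_hyperinterp_error[OF cont_f\<epsilon> continuous_on_const])
      \<comment> \<open>Nonemptiness makes the supremum of the constant 0 equal to 0.\<close>
      finally show ?thesis using \<open>\<Omega> \<noteq> {}\<close> by (simp add: sup_norm_def)
    qed
    have "(\<lambda>n. 2 * sqrt V * best_approx_error n \<Omega> f\<epsilon>) \<longlonglongrightarrow> 2 * sqrt V * 0"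
      by (intro tendsto_intros best_approx_error_tendsto_0 assms cont_f\<epsilon>)
    then have lim: "(\<lambda>n. 2 * sqrt V * best_approx_error n \<Omega> f\<epsilon>) \<longlonglongrightarrow> 0" by simp
    have "(\<lambda>n. ?e n - L2_norm M \<epsilon>) \<longlonglongrightarrow> 0"
      by (rule Lim_null_comparison[OF always_eventually[OF allI[OF le]] lim])
    then show "?e \<longlonglongrightarrow> L2_norm M \<epsilon>" by (simp add: LIM_zero_iff)
  qed
  moreover have "L2_norm M \<epsilon> \<le> sqrt V * sup_norm \<Omega> \<epsilon>"
    unfolding \<open>V = _\<close> by (rule D.L2_norm_le_sup_norm[OF cont(2)])
  ultimately show ?thesis by blast
qed

end
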